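(* Let $G$ be an $n$-vertex graph, and suppose $V(G)$ is the disjoint union of sets $V_1,\dots,V_t$. If $\mathring{s}(G[V_i])\le c_i|V_i|$ for $1\le i\le t$, then $$\mathring{s}(G)\le \Bigl(\sum_{i=1}^t\sqrt{c_i|V_i|}\Bigr)^2 \quad\text{and}\quad \mathring{s}(G)\le \Bigl(\sum_{i=1}^t c_i\Bigr)n.$$
   Context: The slow-coloring game on a graph $G$: initially all vertices are uncolored. In each round, Lister marks a nonempty set $M$ of uncolored vertices and scores $|M|$; Painter then colors (with a new color) a subset $X\subseteq M$ that is independent in $G$. The game ends when all vertices are colored; the score is the sum of the sizes of all marked sets. Painter minimizes, Lister maximizes. The sum-color cost $\mathring{s}(G)$ is the score under optimal play by both players. $G[A]$ denotes the subgraph induced by $A\subseteq V(G)$.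
   Formalization: The constants c_i are assumed nonnegative; this is automatic when V_i is nonempty, and for an empty V_i a negative c_i would make the second inequality false. *)

theory Defs
  imports
    Complex_Main
    "HOL-Library.Disjoint_Sets"
    "HOL-Library.Extended_Real"
    "Graph_Theory.Digraph_Component"
begin

definition independent_set :: "('a, 'b) pre_digraph \<Rightarrow> 'a set \<Rightarrow> bool" where
  "independent_set G X \<longleftrightarrow> X \<subseteq> verts G \<and> (\<forall>u\<in>X. \<forall>v\<in>X. \<not> u \<rightarrow>\<^bsub>G\<^esub> v)"

text \<open>
  A history is the list of the completed rounds, each round being the pair of the set marked by
  Lister and the set coloured by Painter. Both players may use the full history.
\<close>

type_synonym 'a history = "('a set \<times> 'a set) list"
type_synonym 'a lister = "'a history \<Rightarrow> 'a set"
type_synonym 'a painter = "'a history \<Rightarrow> 'a set \<Rightarrow> 'a set"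

definition uncolored :: "('a, 'b) pre_digraph \<Rightarrow> 'a history \<Rightarrow> 'a set" where
  "uncolored G h = verts G - (\<Union>(M, X)\<in>set h. X)"

definition score :: "'a history \<Rightarrow> nat" where
  "score h = (\<Sum>(M, X)\<leftarrow>h. card M)"

definition lister_strategies :: "('a, 'b) pre_digraph \<Rightarrow> 'a lister set" where
  "lister_strategies G =
     {L. \<forall>h. uncolored G h \<noteq> {} \<longrightarrow> L h \<noteq> {} \<and> L h \<subseteq> uncolored G h}"

text \<open>Painter is allowed to colour no vertex at all in a round, so a play need not end.\<close>

definition painter_strategies :: "('a, 'b) pre_digraph \<Rightarrow> 'a painter set" where
  "painter_strategies G =
     {P. \<forall>h M. M \<noteq> {} \<and> M \<subseteq> uncolored G h \<longrightarrow> P h M \<subseteq> M \<and> independent_set G (P h M)}"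

primrec play :: "('a, 'b) pre_digraph \<Rightarrow> 'a lister \<Rightarrow> 'a painter \<Rightarrow> nat \<Rightarrow> 'a history" where
  "play G L P 0 = []"
| "play G L P (Suc k) =
     (let h = play G L P k
      in if uncolored G h = {} then h else h @ [(L h, P h (L h))])"

text \<open>
  The score of a whole play. The supremum is over a sequence that is eventually constant if the
  game ends, and it is \<open>\<infinity>\<close> if the game does not end.
\<close>

definition final_score :: "('a, 'b) pre_digraph \<Rightarrow> 'a lister \<Rightarrow> 'a painter \<Rightarrow> enat" where
  "final_score G L P = (SUP k. enat (score (play G L P k)))"

definition sum_color_cost :: "('a, 'b) pre_digraph \<Rightarrow> enat" where
  "sum_color_cost G =
     (INF P\<in>painter_strategies G. SUP L\<in>lister_strategies G. final_score G L P)"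


text \<open>
  The game on a finite simple graph is determined and has a finite value, which is given by
  backward induction over the set of uncoloured vertices. In particular the order of the infimum
  and the supremum in the definition of \<^const>\<open>sum_color_cost\<close> does not matter.
\<close>

function game_value :: "('a, 'b) pre_digraph \<Rightarrow> 'a set \<Rightarrow> nat" where
  "game_value G U =
     (if finite U \<and> U \<noteq> {}
      then Max ((\<lambda>M. card M + Min ((\<lambda>X. game_value G (U - X)) `
                  {X. X \<noteq> {} \<and> X \<subseteq> M \<inter> U \<and> independent_set G X})) ` {M. M \<noteq> {} \<and> M \<subseteq> U})
      else 0)"
  by auto
termination
  by (relation "measure (\<lambda>(G, U). card U)") (auto intro!: psubset_card_mono)

declare game_value.simps [simp del]

lemma game_value_empty [simp]: "game_value G {} = 0"
  by (simp add: game_value.simps)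

lemma (in graph) independent_singleton:
  "v \<in> verts G \<Longrightarrow> independent_set G {v}"
  by (auto simp: independent_set_def dest: adj_not_same)

lemma (in graph) game_value_painter:
  assumes "U \<subseteq> verts G" "M \<noteq> {}" "M \<subseteq> U"
  shows "\<exists>X\<subseteq>M. independent_set G X \<and> card M + game_value G (U - X) \<le> game_value G U"
proof -
  define I where "I = {X. X \<noteq> {} \<and> X \<subseteq> M \<inter> U \<and> independent_set G X}"
  have fin: "finite U" using assms(1) finite_verts finite_subset by blast
  have finI: "finite I"
    by (rule finite_subset[of _ "Pow U"]) (use fin in \<open>auto simp: I_def\<close>)
  obtain v where "v \<in> M" using assms(2) by blast
  then have "{v} \<in> I" using assms independent_singleton by (auto simp: I_def)
  then have "Min ((\<lambda>X. game_value G (U - X)) ` I) \<in> (\<lambda>X. game_value G (U - X)) ` I"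
    using finI by (intro Min_in) auto
  then obtain X where X: "X \<in> I" "game_value G (U - X) = Min ((\<lambda>X. game_value G (U - X)) ` I)"
    by auto
  have "card M + Min ((\<lambda>X. game_value G (U - X)) ` I) \<le> game_value G U"
    unfolding I_def
    by (subst (2) game_value.simps) (use fin assms in \<open>auto intro!: Max_ge\<close>)
  with X show ?thesis by (auto simp: I_def intro!: exI[of _ X])
qed

lemma (in graph) game_value_lister:
  assumes "U \<subseteq> verts G" "U \<noteq> {}"
  shows "\<exists>M\<subseteq>U. M \<noteq> {} \<and>
    (\<forall>X\<subseteq>M. independent_set G X \<longrightarrow> game_value G U \<le> card M + game_value G (U - X))"
proof -
  define I where "I = (\<lambda>M. {X. X \<noteq> {} \<and> X \<subseteq> M \<inter> U \<and> independent_set G X})"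
  have fin: "finite U" using assms(1) finite_verts finite_subset by blast
  have finI: "finite (I M)" for M
    by (rule finite_subset[of _ "Pow U"]) (use fin in \<open>auto simp: I_def\<close>)
  let ?f = "\<lambda>M. card M + Min ((\<lambda>X. game_value G (U - X)) ` I M)"
  have "game_value G U = Max (?f ` {M. M \<noteq> {} \<and> M \<subseteq> U})"
    unfolding I_def by (subst game_value.simps) (use fin assms in auto)
  moreover have "Max (?f ` {M. M \<noteq> {} \<and> M \<subseteq> U}) \<in> ?f ` {M. M \<noteq> {} \<and> M \<subseteq> U}"
    using fin assms(2) by (intro Max_in) auto
  ultimately obtain M where M: "M \<noteq> {}" "M \<subseteq> U" "game_value G U = ?f M"
    by auto
  have "game_value G U \<le> card M + game_value G (U - X)"
    if X: "X \<subseteq> M" "independent_set G X" for X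
  proof (cases "X = {}")
    case False
    then have "Min ((\<lambda>X. game_value G (U - X)) ` I M) \<le> game_value G (U - X)"
      using finI X M(2) by (intro Min_le) (auto simp: I_def)
    with M show ?thesis by simp
  qed simp
  with M show ?thesis by blast
qed

lemma uncolored_subset: "uncolored G h \<subseteq> verts G"
  by (auto simp: uncolored_def)

lemma uncolored_Nil [simp]: "uncolored G [] = verts G"
  by (simp add: uncolored_def)

lemma uncolored_snoc [simp]: "uncolored G (h @ [(M, X)]) = uncolored G h - X"
  by (auto simp: uncolored_def)

lemma score_simps [simp]: "score [] = 0" "score (h @ [(M, X)]) = score h + card M"
  by (simp_all add: score_def)

lemma (in graph) painter_upper:
  "\<exists>P\<in>painter_strategies G. \<forall>L\<in>lister_strategies G.
     final_score G L P \<le> enat (game_value G (verts G))"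
proof -
  define Q where "Q = (\<lambda>U M X. X \<subseteq> M \<and> independent_set G X \<and>
    card M + game_value G (U - X) \<le> game_value G U)"
  define P where "P = (\<lambda>h M. SOME X. Q (uncolored G h) M X)"
  have P: "Q (uncolored G h) M (P h M)" if "M \<noteq> {}" "M \<subseteq> uncolored G h" for h M
    unfolding P_def using game_value_painter[OF uncolored_subset that]
    by (intro someI_ex[where P = "Q (uncolored G h) M"]) (auto simp: Q_def)
  have "final_score G L P \<le> enat (game_value G (verts G))"
    if L: "L \<in> lister_strategies G" for L
  proof -
    have "score (play G L P k) + game_value G (uncolored G (play G L P k))
            \<le> game_value G (verts G)" for k
    proof (induction k)
      case (Suc k)
      let ?h = "play G L P k"
      show ?case
      proof (cases "uncolored G ?h = {}")
        case False
        then have "Q (uncolored G ?h) (L ?h) (P ?h (L ?h))"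
          using L by (intro P) (auto simp: lister_strategies_def)
        then show ?thesis using Suc False by (simp add: Q_def Let_def)
      qed (use Suc in \<open>simp add: Let_def\<close>)
    qed simp
    then show ?thesis
      unfolding final_score_def by (intro SUP_least) (auto intro: add_leD1)
  qed
  moreover have "P \<in> painter_strategies G"
    using P by (auto simp: painter_strategies_def Q_def)
  ultimately show ?thesis by blast
qed

lemma (in graph) lister_lower:
  "\<exists>L\<in>lister_strategies G. \<forall>P\<in>painter_strategies G.
     enat (game_value G (verts G)) \<le> final_score G L P"
proof -
  define Q where "Q = (\<lambda>U M. M \<subseteq> U \<and> M \<noteq> {} \<and>
    (\<forall>X\<subseteq>M. independent_set G X \<longrightarrow> game_value G U \<le> card M + game_value G (U - X)))"
  define L where "L = (\<lambda>h. SOME M. Q (uncolored G h) M)"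
  have L: "Q (uncolored G h) (L h)" if "uncolored G h \<noteq> {}" for h
    unfolding L_def using game_value_lister[OF uncolored_subset that]
    by (intro someI_ex[where P = "Q (uncolored G h)"]) (auto simp: Q_def)
  have "enat (game_value G (verts G)) \<le> final_score G L P"
    if P: "P \<in> painter_strategies G" for P
  proof -
    let ?u = "\<lambda>k. uncolored G (play G L P k)" and ?s = "\<lambda>k. score (play G L P k)"
    have inv: "game_value G (verts G) \<le> ?s k + game_value G (?u k) \<and> (?u k = {} \<or> k \<le> ?s k)" for k
    proof (induction k)
      case (Suc k)
      let ?h = "play G L P k"
      show ?case
      proof (cases "?u k = {}")
        case False
        then have Q: "Q (?u k) (L ?h)" by (rule L)
        then have "P ?h (L ?h) \<subseteq> L ?h" "independent_set G (P ?h (L ?h))"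
          using P unfolding painter_strategies_def Q_def by auto
        then have "game_value G (?u k) \<le> card (L ?h) + game_value G (?u k - P ?h (L ?h))"
          using Q by (auto simp: Q_def)
        moreover have "finite (L ?h)" "L ?h \<noteq> {}"
          using Q uncolored_subset[of G ?h] finite_verts unfolding Q_def
          by (meson finite_subset)+
        then have "card (L ?h) > 0" by (simp add: card_gt_0_iff)
        ultimately show ?thesis using Suc False by (auto simp: Let_def)
      qed (use Suc in \<open>simp add: Let_def\<close>)
    qed simp
    have "game_value G (verts G) \<le> ?s (game_value G (verts G))"
      using inv[of "game_value G (verts G)"] by auto
    then show ?thesis
      unfolding final_score_def
      by (intro SUP_upper2[of "game_value G (verts G)"]) auto
  qed
  moreover have "L \<in> lister_strategies G"
    using L by (auto simp: lister_strategies_def Q_def)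
  ultimately show ?thesis by blast
qed

theorem (in graph) sum_color_cost_determined:
  shows "sum_color_cost G = enat (game_value G (verts G))"
    and "sum_color_cost G =
           (SUP L\<in>lister_strategies G. INF P\<in>painter_strategies G. final_score G L P)"
proof -
  let ?v = "enat (game_value G (verts G))"
  let ?lower = "SUP L\<in>lister_strategies G. INF P\<in>painter_strategies G. final_score G L P"
  obtain P where P: "P \<in> painter_strategies G"
    "\<And>L. L \<in> lister_strategies G \<Longrightarrow> final_score G L P \<le> ?v"
    using painter_upper by blast
  obtain L where L: "L \<in> lister_strategies G"
    "\<And>P. P \<in> painter_strategies G \<Longrightarrow> ?v \<le> final_score G L P"
    using lister_lower by blast
  have "sum_color_cost G \<le> ?v"
    unfolding sum_color_cost_def by (rule INF_lower2[OF P(1)]) (auto intro: SUP_least P(2))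
  moreover have "?v \<le> sum_color_cost G"
    unfolding sum_color_cost_def by (rule INF_greatest) (auto intro: SUP_upper2 L)
  moreover have "?lower \<le> ?v"
    by (rule SUP_least) (auto intro: INF_lower2 P)
  moreover have "?v \<le> ?lower"
    by (rule SUP_upper2[OF L(1)]) (auto intro: INF_greatest L(2))
  ultimately show "sum_color_cost G = ?v" "sum_color_cost G = ?lower"
    by auto
qed

end

theory Submission
  imports Defs "HOL-Analysis.Convex"
begin

text \<open>
  Let \<open>g\<^sub>i\<close> be the value of the game on the uncoloured vertices of \<open>V\<^sub>i\<close> and \<open>S = \<Sum>\<^sub>i sqrt g\<^sub>i\<close>.
  Painter keeps the value of the whole game below \<open>S\<^sup>2\<close>: when Lister marks \<open>m\<^sub>i\<close> vertices of each
  \<open>V\<^sub>i\<close>, Painter answers optimally inside one part \<open>V\<^sub>i\<close> that maximises \<open>m\<^sub>i / sqrt g\<^sub>i\<close>, which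
  lowers \<open>g\<^sub>i\<close> by at least \<open>m\<^sub>i\<close>, and hence \<open>S\<^sup>2\<close> by at least
  \<open>S m\<^sub>i / sqrt g\<^sub>i \<ge> \<Sum>\<^sub>j m\<^sub>j\<close>. The linear bound then follows by Cauchy-Schwarz.
\<close>

text \<open>With \<open>a = sqrt g\<close> and \<open>b = sqrt (g - m)\<close>, the square drops by
  exactly \<open>2 * (S - a) * (a - b) + m\<close>. Since
  \<open>m = (a - b) * (a + b) \<le> (a - b) * (2 * a)\<close>, this is at least
  \<open>(S - a) * m / a + m = S * m / a\<close>, hence at least \<open>T\<close>.\<close>

lemma square_sqrt_decrease:
  fixes g m S T :: real
  assumes "0 \<le> m" "m \<le> g" "0 < g" "sqrt g \<le> S" "T * sqrt g \<le> S * m"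
  shows "T + (S - sqrt g + sqrt (g - m))\<^sup>2 \<le> S\<^sup>2"
proof -
  define a b where "a = sqrt g" and "b = sqrt (g - m)"
  have a: "a > 0" "a\<^sup>2 = g" and b: "0 \<le> b" "b\<^sup>2 = g - m" and "b \<le> a"
    using assms by (auto simp: a_def b_def)
  have m: "m = (a - b) * (a + b)"
    using a b by (simp add: algebra_simps power2_eq_square)
  have "m \<le> (a - b) * (2 * a)"
    unfolding m using \<open>b \<le> a\<close> by (intro mult_left_mono) auto
  then have "(S - a) * m \<le> (S - a) * ((a - b) * (2 * a))"
    using assms(4) by (intro mult_left_mono) (auto simp: a_def)
  \<comment> \<open>Here \<open>S * m\<close> is split as
    \<open>(S - a) * m + m * a\<close>.\<close>
  then have "T * a \<le> (2 * (S - a) * (a - b) + m) * a"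
    using assms(5) by (simp add: a_def[symmetric] algebra_simps)
  then have "T \<le> 2 * (S - a) * (a - b) + m"
    using a(1) by simp
  also have "\<dots> = S\<^sup>2 - (S - a + b)\<^sup>2"
    unfolding m by (simp add: algebra_simps power2_eq_square)
  finally show ?thesis
    by (simp add: a_def b_def)
qed

text \<open>If no such index existed, \<open>sum w I * m i \<le> sum m I * w i\<close> would hold
  for all \<open>i\<close>, strictly at \<open>k\<close>; but both sides sum to
  \<open>sum w I * sum m I\<close>. The cross-multiplied form avoids division by a weight that may
  be zero.\<close>

lemma exists_weight_ge_average:
  fixes m w :: "'i \<Rightarrow> real"
  assumes "finite I" "\<And>i. i \<in> I \<Longrightarrow> 0 \<le> m i" "\<And>i. i \<in> I \<Longrightarrow> 0 \<le> w i" "k \<in> I" "0 < m k"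
  shows "\<exists>i\<in>I. 0 < m i \<and> sum m I * w i \<le> sum w I * m i"
proof (rule ccontr)
  assume "\<not> ?thesis"
  then have less: "sum w I * m i < sum m I * w i" if "i \<in> I" "0 < m i" for i
    using that by force
  have "sum w I * m i \<le> sum m I * w i" if "i \<in> I" for i
  proof (cases "m i = 0")
    case True
    then show ?thesis using assms that by (simp add: sum_nonneg)
  next
    case False
    then show ?thesis using less[of i] assms(2)[of i] that by simp
  qed
  then have "(\<Sum>i\<in>I. sum w I * m i) < (\<Sum>i\<in>I. sum m I * w i)"
    using less assms by (intro sum_strict_mono_ex1) auto
  then show False
    by (simp flip: sum_distrib_left)
qed

lemma independent_set_induce_subgraph:
  assumes "V \<subseteq> verts G" "X \<subseteq> V"
  shows "independent_set (G \<restriction> V) X \<longleftrightarrow> independent_set G X"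
proof -
  have "u \<rightarrow>\<^bsub>G \<restriction> V\<^esub> v \<longleftrightarrow> u \<rightarrow>\<^bsub>G\<^esub> v" if "u \<in> X" "v \<in> X" for u v
    using that assms(2)
    by (auto simp: arcs_ends_def arc_to_ends_def image_iff)
  then show ?thesis
    using assms by (auto simp: independent_set_def)
qed

text \<open>The recursion sees the graph only through the independent subsets of \<open>U\<close>,
  and these agree in both graphs. This lets all parts be treated inside the single graph
  \<open>G\<close>.\<close>

lemma game_value_induce_subgraph:
  assumes "V \<subseteq> verts G" "U \<subseteq> V"
  shows "game_value (G \<restriction> V) U = game_value G U"
proof (cases "finite U")
  case True
  then show ?thesis
    using assms(2)
  proof (induction U rule: finite_psubset_induct)
    case (psubset U)
    have *: "(\<lambda>X. game_value (G \<restriction> V) (U - X)) `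
                {X. X \<noteq> {} \<and> X \<subseteq> M \<inter> U \<and> independent_set (G \<restriction> V) X} =
             (\<lambda>X. game_value G (U - X)) ` {X. X \<noteq> {} \<and> X \<subseteq> M \<inter> U \<and> independent_set G X}"
      for M
    proof (rule image_cong)
      show "{X. X \<noteq> {} \<and> X \<subseteq> M \<inter> U \<and> independent_set (G \<restriction> V) X} =
            {X. X \<noteq> {} \<and> X \<subseteq> M \<inter> U \<and> independent_set G X}"
        using psubset.prems independent_set_induce_subgraph[OF assms(1)]
        by (intro Collect_cong) (meson inf.boundedE subset_trans)
    next
      fix X
      assume "X \<in> {X. X \<noteq> {} \<and> X \<subseteq> M \<inter> U \<and> independent_set G X}"
      then show "game_value (G \<restriction> V) (U - X) = game_value G (U - X)"
        using psubset.prems by (intro psubset.IH) auto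
    qed
    show ?case
      by (subst (1 2) game_value.simps) (simp only: *)
  qed
qed (simp add: game_value.simps)

context graph
begin

text \<open>Lister can score \<open>card M\<close> in the first round by marking \<open>M\<close>.
  This keeps the radicand \<open>g - m\<close> nonnegative below.\<close>

lemma card_le_game_value:
  assumes "M \<subseteq> U" "U \<subseteq> verts G"
  shows "card M \<le> game_value G U"
  using game_value_painter[OF assms(2) _ assms(1)] by (cases "M = {}") auto

text \<open>Stating the bound for every set \<open>U\<close> of uncolored vertices makes it
  available for \<open>U - X\<close> after a round.\<close>

lemma game_value_le_square_sum_sqrt:
  fixes V :: "'i \<Rightarrow> 'a set"
  assumes "finite I" "disjoint_family_on V I" "U \<subseteq> (\<Union>i\<in>I. V i)" "U \<subseteq> verts G"
  shows "real (game_value G U) \<le> (\<Sum>i\<in>I. sqrt (real (game_value G (U \<inter> V i))))\<^sup>2"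
proof -
  have "finite U" using assms(4) finite_verts finite_subset by blast
  then show ?thesis
    using assms(3,4)
  proof (induction U rule: finite_psubset_induct)
    case (psubset U)
    define g where "g = (\<lambda>U i. real (game_value G (U \<inter> V i)))"
    define S where "S = (\<lambda>U. \<Sum>i\<in>I. sqrt (g U i))"
    have g_nonneg: "0 \<le> g U i" for U i by (simp add: g_def)
    show ?case
    proof (cases "U = {}")
      case False
      then obtain M where M: "M \<subseteq> U" "M \<noteq> {}"
        and lister: "\<And>X. X \<subseteq> M \<Longrightarrow> independent_set G X \<Longrightarrow>
          game_value G U \<le> card M + game_value G (U - X)"
        using game_value_lister[OF psubset.prems(2)] by blast
      have fin: "finite M" using M psubset.hyps finite_subset by blast
      define m where "m = (\<lambda>i. real (card (M \<inter> V i)))"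
      have m_le: "m i \<le> g U i" for i
        unfolding m_def g_def
        using M(1) psubset.prems(2) by (intro of_nat_mono card_le_game_value) auto
      have "card M = card (\<Union>i\<in>I. M \<inter> V i)"
        using M(1) psubset.prems(1) by (intro arg_cong[where f = card]) auto
      also have "\<dots> = (\<Sum>i\<in>I. card (M \<inter> V i))"
        using assms(1,2) fin by (intro card_UN_disjoint) (auto simp: disjoint_family_on_def)
      finally have sum_m: "real (card M) = sum m I" by (simp add: m_def)
      obtain v k where "v \<in> M" "k \<in> I" "v \<in> V k"
        using M psubset.prems(1) by blast
      then have "0 < m k" using fin by (auto simp: m_def card_gt_0_iff)
      then obtain i where i: "i \<in> I" "0 < m i" "sum m I * sqrt (g U i) \<le> S U * m i"
        using exists_weight_ge_average[of I m "\<lambda>i. sqrt (g U i)" k] assms(1) \<open>k \<in> I\<close> g_nonneg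
        by (auto simp: S_def m_def)
      have "M \<inter> V i \<noteq> {}" using i(2) by (auto simp: m_def)
      then obtain X where X: "X \<subseteq> M \<inter> V i" "independent_set G X"
        and painter: "card (M \<inter> V i) + game_value G (U \<inter> V i - X) \<le> game_value G (U \<inter> V i)"
        using game_value_painter[of "U \<inter> V i" "M \<inter> V i"] M(1) psubset.prems(2) by blast
      \<comment> \<open>An empty answer would give \<open>m i \<le> 0\<close> in
        \<open>painter\<close>. Thus \<open>U - X\<close> is a proper subset and the induction
        hypothesis applies.\<close>
      have "X \<noteq> {}" using painter i(2) by (auto simp: m_def)
      have "U \<inter> V i - X = (U - X) \<inter> V i" by auto
      then have g_i: "g (U - X) i \<le> g U i - m i"
        using painter by (simp add: g_def m_def flip: of_nat_add)
      \<comment> \<open>Since \<open>X\<close> lies in \<open>V i\<close>, disjointness leaves every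
        other part untouched, so only one summand of \<open>S\<close> changes.\<close>
      have g_j: "g (U - X) j = g U j" if "j \<in> I - {i}" for j
      proof -
        have "V i \<inter> V j = {}"
          using assms(2) i(1) that by (auto simp: disjoint_family_on_def)
        then have "(U - X) \<inter> V j = U \<inter> V j" using X(1) by auto
        then show ?thesis by (simp add: g_def)
      qed
      have split: "S W = sqrt (g W i) + (\<Sum>j\<in>I - {i}. sqrt (g W j))" for W
        unfolding S_def using assms(1) i(1) by (rule sum.remove)
      have "(\<Sum>j\<in>I - {i}. sqrt (g (U - X) j)) = (\<Sum>j\<in>I - {i}. sqrt (g U j))"
        by (intro sum.cong) (simp_all add: g_j)
      then have "S (U - X) \<le> S U - sqrt (g U i) + sqrt (g U i - m i)"
        using g_i by (simp add: split)
      moreover have "0 \<le> S (U - X)"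
        by (simp add: S_def sum_nonneg g_nonneg)
      ultimately have "(S (U - X))\<^sup>2 \<le> (S U - sqrt (g U i) + sqrt (g U i - m i))\<^sup>2"
        by (intro power_mono)
      moreover have "real (game_value G (U - X)) \<le> (S (U - X))\<^sup>2"
        unfolding S_def g_def
        by (rule psubset.IH) (use X(1) M(1) \<open>X \<noteq> {}\<close> psubset.prems in auto)
      moreover have "real (game_value G U) \<le> real (card M) + real (game_value G (U - X))"
        using lister[of X] X by (simp flip: of_nat_add)
      \<comment> \<open>The choice of \<open>i\<close> is the condition with
        \<open>T = sum m I\<close>: progress in one part pays for the whole marked set.\<close>
      moreover have "sum m I + (S U - sqrt (g U i) + sqrt (g U i - m i))\<^sup>2 \<le> (S U)\<^sup>2"
      proof (rule square_sqrt_decrease)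
        show "sqrt (g U i) \<le> S U"
          by (simp add: split sum_nonneg g_nonneg)
      qed (use i m_le[of i] in auto)
      ultimately have "real (game_value G U) \<le> (S U)\<^sup>2"
        using sum_m by linarith
      then show ?thesis by (simp add: S_def g_def)
    qed simp
  qed
qed

end

theorem theorem1:
  fixes G :: "('a, 'b) pre_digraph"
    and V :: "nat \<Rightarrow> 'a set"
    and c :: "nat \<Rightarrow> real"
    and n t :: nat
  assumes "graph G"
    and "card (verts G) = n"
    and "disjoint_family_on V {1..t}"
    and "(\<Union>i\<in>{1..t}. V i) = verts G"
    and "\<And>i. i \<in> {1..t} \<Longrightarrow> 0 \<le> c i"
    and "\<And>i. i \<in> {1..t} \<Longrightarrow>
           ereal_of_enat (sum_color_cost (G \<restriction> V i)) \<le> ereal (c i * real (card (V i)))"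
  shows "ereal_of_enat (sum_color_cost G) \<le> ereal ((\<Sum>i=1..t. sqrt (c i * real (card (V i))))\<^sup>2)
       \<and> ereal_of_enat (sum_color_cost G) \<le> ereal ((\<Sum>i=1..t. c i) * real n)"
proof -
  interpret graph G by fact
  have V: "V i \<subseteq> verts G" if "i \<in> {1..t}" for i
    using assms(4) that by auto
  have part: "real (game_value G (V i)) \<le> c i * real (card (V i))" if "i \<in> {1..t}" for i
  proof -
    interpret H: graph "G \<restriction> V i"
      using induced_induce[OF V[OF that]]
      by (intro graph.intro pseudo_graph.intro digraphI_induced induced_graph_imp_graph
          digraph.axioms(1))
    show ?thesis
      using assms(6)[OF that] game_value_induce_subgraph[OF V[OF that], of "V i"]
      by (simp add: H.sum_color_cost_determined(1))
  qed
  have "real (game_value G (verts G)) \<le> (\<Sum>i=1..t. sqrt (real (game_value G (verts G \<inter> V i))))\<^sup>2"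
    using assms(3,4) by (intro game_value_le_square_sum_sqrt) auto
  also have "\<dots> \<le> (\<Sum>i=1..t. sqrt (c i * real (card (V i))))\<^sup>2"
    using part V by (intro power_mono sum_mono sum_nonneg) (auto simp: Int_absorb1)
  finally have main:
    "real (game_value G (verts G)) \<le> (\<Sum>i=1..t. sqrt (c i * real (card (V i))))\<^sup>2" .
  \<comment> \<open>Cauchy-Schwarz for the vectors \<open>sqrt (c i)\<close> and
    \<open>sqrt (card (V i))\<close>; the squares then simplify by
    \<open>0 \<le> c i\<close>.\<close>
  also have "\<dots> \<le> (\<Sum>i=1..t. (sqrt (c i))\<^sup>2) * (\<Sum>i=1..t. (sqrt (real (card (V i))))\<^sup>2)"
    unfolding real_sqrt_mult by (rule Cauchy_Schwarz_ineq_sum)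
  also have "(\<Sum>i=1..t. (sqrt (c i))\<^sup>2) = (\<Sum>i=1..t. c i)"
    using assms(5) by (intro sum.cong) auto
  also have "(\<Sum>i=1..t. (sqrt (real (card (V i))))\<^sup>2) = real n"
  proof -
    have "n = (\<Sum>i=1..t. card (V i))"
      unfolding assms(2)[symmetric] assms(4)[symmetric]
      using assms(3) V finite_subset[OF _ finite_verts]
      by (intro card_UN_disjoint) (auto simp: disjoint_family_on_def)
    then show ?thesis by simp
  qed
  finally show ?thesis
    using main by (simp add: sum_color_cost_determined(1))
qed

end
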